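(* Let $\Bbbk$ be an algebraically closed field of characteristic $p>0$. Suppose $G$ is a finite group and $P$ a Sylow $p$-subgroup of $G$. If $U$ is a (finite-dimensional) projective $G$-module over $\Bbbk$, then $\epsilon(G,u)=|P|$ for any $u\in U^G\setminus\{0\}$. In particular, $\epsilon(G,U)=|P|$ if $U^G\neq\{0\}$.
   Context: For a finite-dimensional $G$-module $U$, $\Bbbk[U]\cong S(U^* )$ is the ring of polynomial functions on $U$, with $G$-action $(g\cdot f)(u)=f(g^{-1}u)$; $\Bbbk[U]^G_d$ is the set of homogeneous invariants of degree $d$ together with $0$. The nullcone $\mathcal{N}_{G,U}$ is the common zero set in $U$ of all invariants with constant term zero. For $u\in U$, $\epsilon(G,u)=\inf\{d\in\mathbb{N}_{>0} : \text{there exists } f\in\Bbbk[U]^G_d\text{ with } f(u)\neq 0\}$, where the infimum of the empty set is $\infty$, and $\epsilon(G,U)=\inf\{\epsilon(G,u): u\in U^G\setminus\mathcal{N}_{G,U}\}$. *)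

theory Defs
  imports
    "HOL-Algebra.Coset"
    "HOL-Computational_Algebra.Computational_Algebra"
    "HOL-Library.Extended_Nat"
begin

text \<open>
  The field is a type \<open>'k\<close>, the underlying vector space of a \<open>G\<close>-module \<open>U\<close> is a whole type \<open>'v\<close>
  with scalar multiplication \<open>scale\<close>, and \<open>\<rho> g\<close> is the action of \<open>g\<close>. The values of \<open>\<rho>\<close> outside
  \<open>carrier G\<close> are irrelevant.
\<close>

locale G_module =
  group G + vector_space scale
  for G :: "'g monoid" (structure)
    and scale :: "'k::field \<Rightarrow> 'v::ab_group_add \<Rightarrow> 'v"
    and \<rho> :: "'g \<Rightarrow> 'v \<Rightarrow> 'v" +
  assumes action_linear: "g \<in> carrier G \<Longrightarrow> Vector_Spaces.linear scale scale (\<rho> g)"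
    and action_one: "\<rho> \<one> u = u"
    and action_mult: "g \<in> carrier G \<Longrightarrow> h \<in> carrier G \<Longrightarrow> \<rho> (g \<otimes> h) u = \<rho> g (\<rho> h u)"

locale fin_dim_G_module = G_module +
  assumes finite_dimensional: "\<exists>B. finite_dimensional_vector_space scale B"

definition fixed_points :: "('g, 'm) monoid_scheme \<Rightarrow> ('g \<Rightarrow> 'v \<Rightarrow> 'v) \<Rightarrow> 'v set" where
  "fixed_points G \<rho> = {u. \<forall>g\<in>carrier G. \<rho> g u = u}"

definition sylow_subgroup :: "nat \<Rightarrow> 'g set \<Rightarrow> ('g, 'm) monoid_scheme \<Rightarrow> bool" where
  "sylow_subgroup p P G \<longleftrightarrow> subgroup P G \<and> card P = p ^ multiplicity p (Coset.order G)"

subsection \<open>Projective modules\<close>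

text \<open>
  The free module \<open>(kG)\<^sup>n\<close>, for \<open>G\<close> finite: \<open>x i\<close> with \<open>i < n\<close> is the element
  \<open>\<Sum>g\<in>G. x i g \<cdot> g\<close> of the group algebra in the \<open>i\<close>-th component, so that the left action of \<open>h\<close>
  moves the coefficient of \<open>h\<^sup>-\<^sup>1 g\<close> to \<open>g\<close>.
\<close>

definition free_module :: "('g, 'm) monoid_scheme \<Rightarrow> nat \<Rightarrow> (nat \<Rightarrow> 'g \<Rightarrow> 'k::field) set" where
  "free_module G n = {x. \<forall>i g. x i g \<noteq> 0 \<longrightarrow> i < n \<and> g \<in> carrier G}"

definition free_action ::
  "('g, 'm) monoid_scheme \<Rightarrow> 'g \<Rightarrow> (nat \<Rightarrow> 'g \<Rightarrow> 'k::field) \<Rightarrow> nat \<Rightarrow> 'g \<Rightarrow> 'k" where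
  "free_action G h x = (\<lambda>i g. if g \<in> carrier G then x i (inv\<^bsub>G\<^esub> h \<otimes>\<^bsub>G\<^esub> g) else 0)"

definition hom_to_free ::
  "('g, 'm) monoid_scheme \<Rightarrow> ('k::field \<Rightarrow> 'v::ab_group_add \<Rightarrow> 'v) \<Rightarrow> ('g \<Rightarrow> 'v \<Rightarrow> 'v) \<Rightarrow> nat
    \<Rightarrow> ('v \<Rightarrow> nat \<Rightarrow> 'g \<Rightarrow> 'k) set" where
  "hom_to_free G scale \<rho> n = {\<iota>.
     (\<forall>u. \<iota> u \<in> free_module G n) \<and>
     (\<forall>u v. \<iota> (u + v) = (\<lambda>i g. \<iota> u i g + \<iota> v i g)) \<and>
     (\<forall>c u. \<iota> (scale c u) = (\<lambda>i g. c * \<iota> u i g)) \<and>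
     (\<forall>h\<in>carrier G. \<forall>u. \<iota> (\<rho> h u) = free_action G h (\<iota> u))}"

definition hom_from_free ::
  "('g, 'm) monoid_scheme \<Rightarrow> ('k::field \<Rightarrow> 'v::ab_group_add \<Rightarrow> 'v) \<Rightarrow> ('g \<Rightarrow> 'v \<Rightarrow> 'v) \<Rightarrow> nat
    \<Rightarrow> ((nat \<Rightarrow> 'g \<Rightarrow> 'k) \<Rightarrow> 'v) set" where
  "hom_from_free G scale \<rho> n = {\<pi>.
     (\<forall>x\<in>free_module G n. \<forall>y\<in>free_module G n. \<pi> (\<lambda>i g. x i g + y i g) = \<pi> x + \<pi> y) \<and>
     (\<forall>c. \<forall>x\<in>free_module G n. \<pi> (\<lambda>i g. c * x i g) = scale c (\<pi> x)) \<and>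
     (\<forall>h\<in>carrier G. \<forall>x\<in>free_module G n. \<pi> (free_action G h x) = \<rho> h (\<pi> x))}"

text \<open>
  Projective means: direct summand of a free module. Free modules of finite rank suffice, since the
  definition is only used for finite-dimensional \<open>U\<close> and the image of such a \<open>U\<close> in any free module
  lies in the span of finitely many basis elements. (The lifting property is not used as the
  definition because it quantifies over modules on arbitrary types.)
\<close>

definition projective_module ::
  "('g, 'm) monoid_scheme \<Rightarrow> ('k::field \<Rightarrow> 'v::ab_group_add \<Rightarrow> 'v) \<Rightarrow> ('g \<Rightarrow> 'v \<Rightarrow> 'v) \<Rightarrow> bool" where
  "projective_module G scale \<rho> \<longleftrightarrow>
     (\<exists>n. \<exists>\<iota>\<in>hom_to_free G scale \<rho> n. \<exists>\<pi>\<in>hom_from_free G scale \<rho> n. \<forall>u. \<pi> (\<iota> u) = u)"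

subsection \<open>Polynomial functions and invariants\<close>

inductive_set polynomial_functions :: "('k::field \<Rightarrow> 'v::ab_group_add \<Rightarrow> 'v) \<Rightarrow> ('v \<Rightarrow> 'k) set"
  for scale where
  const: "(\<lambda>u. c) \<in> polynomial_functions scale"
| functional: "Vector_Spaces.linear scale (*) l \<Longrightarrow> l \<in> polynomial_functions scale"
| add: "f \<in> polynomial_functions scale \<Longrightarrow> f' \<in> polynomial_functions scale
    \<Longrightarrow> (\<lambda>u. f u + f' u) \<in> polynomial_functions scale"
| mult: "f \<in> polynomial_functions scale \<Longrightarrow> f' \<in> polynomial_functions scale
    \<Longrightarrow> (\<lambda>u. f u * f' u) \<in> polynomial_functions scale"

text \<open>
  The image of \<open>S\<^sup>d(U\<^sup>*)\<close>: finite linear combinations of products of \<open>d\<close> linear functionals. The zero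
  function belongs to it for every \<open>d\<close>.
\<close>

definition homogeneous_functions ::
  "('k::field \<Rightarrow> 'v::ab_group_add \<Rightarrow> 'v) \<Rightarrow> nat \<Rightarrow> ('v \<Rightarrow> 'k) set" where
  "homogeneous_functions scale d =
     {(\<lambda>u. \<Sum>j<m. c j * (\<Prod>i<d. l j i u)) | m (c :: nat \<Rightarrow> 'k) (l :: nat \<Rightarrow> nat \<Rightarrow> 'v \<Rightarrow> 'k).
        \<forall>j<m. \<forall>i<d. Vector_Spaces.linear scale (*) (l j i)}"

definition function_action ::
  "('g, 'm) monoid_scheme \<Rightarrow> ('g \<Rightarrow> 'v \<Rightarrow> 'v) \<Rightarrow> 'g \<Rightarrow> ('v \<Rightarrow> 'k) \<Rightarrow> 'v \<Rightarrow> 'k" where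
  "function_action G \<rho> g f = (\<lambda>u. f (\<rho> (inv\<^bsub>G\<^esub> g) u))"

definition invariants ::
  "('g, 'm) monoid_scheme \<Rightarrow> ('k::field \<Rightarrow> 'v::ab_group_add \<Rightarrow> 'v) \<Rightarrow> ('g \<Rightarrow> 'v \<Rightarrow> 'v)
    \<Rightarrow> ('v \<Rightarrow> 'k) set" where
  "invariants G scale \<rho> =
     {f \<in> polynomial_functions scale. \<forall>g\<in>carrier G. function_action G \<rho> g f = f}"

definition homogeneous_invariants ::
  "('g, 'm) monoid_scheme \<Rightarrow> ('k::field \<Rightarrow> 'v::ab_group_add \<Rightarrow> 'v) \<Rightarrow> ('g \<Rightarrow> 'v \<Rightarrow> 'v) \<Rightarrow> nat
    \<Rightarrow> ('v \<Rightarrow> 'k) set" where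
  "homogeneous_invariants G scale \<rho> d =
     {f \<in> homogeneous_functions scale d. \<forall>g\<in>carrier G. function_action G \<rho> g f = f}"

text \<open>The constant term of a polynomial function is its value at \<open>0\<close>.\<close>

definition nullcone ::
  "('g, 'm) monoid_scheme \<Rightarrow> ('k::field \<Rightarrow> 'v::ab_group_add \<Rightarrow> 'v) \<Rightarrow> ('g \<Rightarrow> 'v \<Rightarrow> 'v) \<Rightarrow> 'v set" where
  "nullcone G scale \<rho> = {u. \<forall>f\<in>invariants G scale \<rho>. f 0 = 0 \<longrightarrow> f u = 0}"

text \<open>In \<^typ>\<open>enat\<close> the infimum of the empty set is \<open>\<infinity>\<close>.\<close>

definition epsilon_point ::
  "('g, 'm) monoid_scheme \<Rightarrow> ('k::field \<Rightarrow> 'v::ab_group_add \<Rightarrow> 'v) \<Rightarrow> ('g \<Rightarrow> 'v \<Rightarrow> 'v) \<Rightarrow> 'v \<Rightarrow> enat" where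
  "epsilon_point G scale \<rho> u =
     Inf {enat d | d. d > 0 \<and> (\<exists>f\<in>homogeneous_invariants G scale \<rho> d. f u \<noteq> 0)}"

definition epsilon ::
  "('g, 'm) monoid_scheme \<Rightarrow> ('k::field \<Rightarrow> 'v::ab_group_add \<Rightarrow> 'v) \<Rightarrow> ('g \<Rightarrow> 'v \<Rightarrow> 'v) \<Rightarrow> enat" where
  "epsilon G scale \<rho> =
     Inf (epsilon_point G scale \<rho> ` (fixed_points G \<rho> - nullcone G scale \<rho>))"

end

theory Submission
  imports Defs "HOL-Algebra.Group_Action"
begin

text \<open>
  Upper bound: for a linear functional \<open>l\<close> with \<open>l u = 1\<close>, the transfer from \<open>P\<close> to \<open>G\<close> of the norm
  \<open>\<Prod>h\<in>P. l \<circ> \<rho> h\<close> is an invariant of degree \<open>|P|\<close>, whose value at the fixed point \<open>u\<close> is the index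
  of \<open>P\<close>, which is prime to \<open>p\<close>.

  Lower bound: in a projective module every fixed point is a trace \<open>u = \<Sum>g. \<rho> g w\<close>. For an invariant
  \<open>f\<close> of degree \<open>d\<close>, the function \<open>t \<mapsto> f (\<Sum>g. t g \<cdot> \<rho> g w)\<close> is a form in the variables \<open>t g\<close>, and \<open>P\<close>
  permutes its monomials and preserves their coefficients. The value \<open>f u\<close> is the sum of all
  coefficients. Modulo \<open>p\<close> only the monomials fixed by \<open>P\<close> contribute, and the exponents of such a
  monomial are constant on the cosets \<open>P g\<close>, so that \<open>d \<ge> |P|\<close> if \<open>d > 0\<close>.
\<close>

lemma infinite_UNIV_alg_closed_field: "infinite (UNIV :: 'k::alg_closed_field set)"
proof
  assume fin: "finite (UNIV :: 'k set)"
  define q where "q = (\<Prod>a\<in>(UNIV :: 'k set). [:-a, 1:])"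
  have "degree q = card (UNIV :: 'k set)"
    unfolding q_def by (subst degree_prod_sum_eq) auto
  then have "degree q > 0"
    using fin by (simp add: card_gt_0_iff)
  then have "degree (q + 1) > 0"
    by (simp add: degree_add_eq_left)
  then obtain x where "poly (q + 1) x = 0"
    using alg_closed_imp_poly_has_root by blast
  moreover have "poly q x = 0"
    unfolding q_def poly_prod using fin by (subst prod_zero_iff) auto
  ultimately show False by simp
qed

lemma monomials_independent:
  fixes a :: "('x \<Rightarrow> nat) \<Rightarrow> 'k::idom"
  assumes "infinite (UNIV :: 'k set)" "finite X" "finite M"
    and "\<And>m m'. \<lbrakk>m \<in> M; m' \<in> M; \<forall>x\<in>X. m x = m' x\<rbrakk> \<Longrightarrow> m = m'"
    and "\<And>t. (\<Sum>m\<in>M. a m * (\<Prod>x\<in>X. t x ^ m x)) = 0"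
    and "m \<in> M"
  shows "a m = 0"
  using assms(2-6)
proof (induction X arbitrary: M rule: finite_induct)
  case empty
  then have "M = {m}" by blast
  with empty show ?case by simp
next
  case (insert y X)
  define N where "N k = {m' \<in> M. m' y = k}" for k
  define b where "b t k = (\<Sum>m'\<in>N k. a m' * (\<Prod>x\<in>X. t x ^ m' x))" for t k
  have fin: "finite (N k)" for k
    using insert.prems unfolding N_def by auto
  have b0: "b t k = 0" for t k
  proof (cases "k \<in> (\<lambda>m'. m' y) ` M")
    case False
    then have "N k = {}" by (auto simp: N_def)
    then show ?thesis by (simp add: b_def)
  next
    case True
    define q where "q = (\<Sum>k\<in>(\<lambda>m'. m' y) ` M. monom (b t k) k)"
    have "poly q s = 0" for s
    proof -
      have eq: "(\<Prod>x\<in>insert y X. (t(y := s)) x ^ m' x) = s ^ m' y * (\<Prod>x\<in>X. t x ^ m' x)" for m'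
        using insert.hyps by (simp, intro disjI2 prod.cong) auto
      have "poly q s = (\<Sum>k\<in>(\<lambda>m'. m' y) ` M. \<Sum>m'\<in>N k. a m' * (s ^ m' y * (\<Prod>x\<in>X. t x ^ m' x)))"
        unfolding q_def poly_sum poly_monom b_def sum_distrib_right
        by (intro sum.cong refl) (auto simp: N_def algebra_simps)
      also have "\<dots> = (\<Sum>m'\<in>M. a m' * (s ^ m' y * (\<Prod>x\<in>X. t x ^ m' x)))"
        unfolding N_def by (rule sum.image_gen [symmetric]) (fact insert.prems)
      also have "\<dots> = 0"
        using insert.prems(3)[of "t(y := s)"] unfolding eq .
      finally show ?thesis .
    qed
    then have "q = 0"
      using poly_roots_finite[of q] assms(1) by auto
    then have "coeff q k = 0" by simp
    then show ?thesis
      using True insert.prems(1) unfolding q_def coeff_sum by (simp add: sum.delta)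
  qed
  show ?case
  proof (rule insert.IH[of "N (m y)"])
    show "finite (N (m y))" by (fact fin)
    show "m' = m''" if "m' \<in> N (m y)" "m'' \<in> N (m y)" "\<forall>x\<in>X. m' x = m'' x" for m' m''
      using that by (intro insert.prems(2)) (auto simp: N_def)
    show "(\<Sum>m'\<in>N (m y). a m' * (\<Prod>x\<in>X. t x ^ m' x)) = 0" for t
      using b0 unfolding b_def .
    show "m \<in> N (m y)" using insert.prems by (auto simp: N_def)
  qed
qed

lemma (in group) group_action_restrict:
  assumes cl: "\<And>g x. \<lbrakk>g \<in> carrier G; x \<in> E\<rbrakk> \<Longrightarrow> act g x \<in> E"
    and one: "\<And>x. x \<in> E \<Longrightarrow> act \<one> x = x"
    and mult: "\<And>g h x. \<lbrakk>g \<in> carrier G; h \<in> carrier G; x \<in> E\<rbrakk> \<Longrightarrow> act (g \<otimes> h) x = act g (act h x)"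
  shows "group_action G E (\<lambda>g. restrict (act g) E)"
proof -
  have Bij: "restrict (act g) E \<in> Bij E" if "g \<in> carrier G" for g
  proof -
    have "bij_betw (act g) E E"
      using that cl by (intro bij_betwI[where g = "act (inv g)"]) (auto simp flip: mult simp: one)
    then show ?thesis by (simp add: Bij_def cong: bij_betw_cong)
  qed
  have "(\<lambda>g. restrict (act g) E) \<in> hom G (BijGroup E)"
  proof (rule homI)
    show "restrict (act g) E \<in> carrier (BijGroup E)" if "g \<in> carrier G" for g
      using Bij[OF that] by (simp add: BijGroup_def)
    show "restrict (act (g \<otimes> h)) E = restrict (act g) E \<otimes>\<^bsub>BijGroup E\<^esub> restrict (act h) E"
      if "g \<in> carrier G" "h \<in> carrier G" for g h
      using that Bij by (intro ext) (simp add: BijGroup_def compose_def mult cl)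
  qed
  then show ?thesis
    using group_BijGroup[of E] is_group
    by (simp add: group_action_def group_hom_def group_hom_axioms_def)
qed

lemma (in group_action) p_group_sum_eq_0:
  fixes f :: "'c \<Rightarrow> 'r::comm_ring_1"
  assumes p: "prime p" "CHAR('r) = p" and ord: "Coset.order G = p ^ k" and "finite E"
    and inv: "\<And>g x. \<lbrakk>g \<in> carrier G; x \<in> E\<rbrakk> \<Longrightarrow> f (\<phi> g x) = f x"
    and nofix: "\<And>x. x \<in> E \<Longrightarrow> \<exists>g\<in>carrier G. \<phi> g x \<noteq> x"
  shows "(\<Sum>x\<in>E. f x) = 0"
proof -
  have "(\<Sum>y\<in>O'. f y) = 0" if O': "O' \<in> orbits G E \<phi>" for O'
  proof -
    obtain x where x: "x \<in> E" "O' = orbit G \<phi> x"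
      using O' unfolding orbits_def by blast
    have sub: "O' \<subseteq> E" using x element_image by (auto simp: orbit_def)
    have "(\<Sum>y\<in>O'. f y) = (\<Sum>y\<in>O'. f x)"
      using x inv by (intro sum.cong) (auto simp: orbit_def)
    also have "\<dots> = of_nat (card O') * f x" by simp
    also have "p dvd card O'"
    proof -
      have "card O' dvd p ^ k"
        using orbit_stabilizer_theorem[OF x(1)] unfolding x(2) ord by (metis dvd_triv_left)
      then obtain i where i: "card O' = p ^ i"
        using divides_primepow_nat[OF p(1)] by blast
      have "card O' \<noteq> 1"
      proof
        assume "card O' = 1"
        moreover have "x \<in> O'" using x orbit_refl by simp
        ultimately have "O' = {x}" by (auto simp: card_1_singleton_iff)
        moreover obtain g where "g \<in> carrier G" "\<phi> g x \<noteq> x" using nofix x by blast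
        ultimately show False unfolding x(2) orbit_def by blast
      qed
      with i show ?thesis by (cases i) auto
    qed
    then have "(of_nat (card O') :: 'r) = 0"
      using p(2) by (simp add: of_nat_eq_0_iff_char_dvd)
    finally show ?thesis by simp
  qed
  then show ?thesis
    using disjoint_sum[OF \<open>finite E\<close>, of f] by simp
qed

lemma finite_exponents:
  assumes "finite X"
  shows "finite {m :: 'x \<Rightarrow> nat. (\<forall>x. x \<notin> X \<longrightarrow> m x = 0) \<and> sum m X = d}"
proof (rule finite_subset)
  show "{m. (\<forall>x. x \<notin> X \<longrightarrow> m x = 0) \<and> sum m X = d}
      \<subseteq> {m. \<forall>x. (x \<in> X \<longrightarrow> m x \<in> {..d}) \<and> (x \<notin> X \<longrightarrow> m x = 0)}"
    using member_le_sum[OF _ _ assms] by force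
  show "finite {m :: 'x \<Rightarrow> nat. \<forall>x. (x \<in> X \<longrightarrow> m x \<in> {..d}) \<and> (x \<notin> X \<longrightarrow> m x = 0)}"
    using assms by (intro finite_set_of_finite_funs) auto
qed

lemma homogeneous_on_combinations:
  fixes v :: "'x \<Rightarrow> 'v::ab_group_add" and scale :: "'k::field \<Rightarrow> 'v \<Rightarrow> 'v"
  assumes f: "f \<in> homogeneous_functions scale d" and X: "finite X"
  obtains A where "\<And>t. f (\<Sum>x\<in>X. scale (t x) (v x)) =
    (\<Sum>m | (\<forall>x. x \<notin> X \<longrightarrow> m x = 0) \<and> sum m X = d. A m * (\<Prod>x\<in>X. t x ^ m x))"
proof -
  let ?M = "{m. (\<forall>x. x \<notin> X \<longrightarrow> m x = 0) \<and> sum m X = d}"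
  obtain n :: nat and c l where fdef: "f = (\<lambda>u. \<Sum>j<n. c j * (\<Prod>i<d. l j i u))"
    and lin: "\<forall>j<n. \<forall>i<d. Vector_Spaces.linear scale (*) (l j i)"
    using f unfolding homogeneous_functions_def mem_Collect_eq
    by (elim exE conjE) (rule that)
  let ?\<Phi> = "PiE {..<d} (\<lambda>_. X)"
  define cnt :: "(nat \<Rightarrow> 'x) \<Rightarrow> 'x \<Rightarrow> nat"
    where "cnt \<phi> x = (if x \<in> X then card {i\<in>{..<d}. \<phi> i = x} else 0)" for \<phi> x
  define B where "B \<phi> = (\<Sum>j<n. c j * (\<Prod>i<d. l j i (v (\<phi> i))))" for \<phi>
  have fin\<Phi>: "finite ?\<Phi>" using X by (intro finite_PiE) auto
  have finM: "finite ?M" by (rule finite_exponents [OF X])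
  have "sum (cnt \<phi>) X = d" if "\<phi> \<in> ?\<Phi>" for \<phi>
  proof -
    have "sum (cnt \<phi>) X = (\<Sum>x\<in>X. \<Sum>i\<in>{i\<in>{..<d}. \<phi> i = x}. 1)"
      by (intro sum.cong refl) (simp add: cnt_def)
    also have "\<dots> = (\<Sum>i<d. 1)"
      using that X by (intro sum.group) auto
    finally show ?thesis by simp
  qed
  then have cntM: "cnt ` ?\<Phi> \<subseteq> ?M"
    by (intro image_subsetI CollectI conjI) (simp_all add: cnt_def)
  have mono: "(\<Prod>i<d. t (\<phi> i)) = (\<Prod>x\<in>X. t x ^ cnt \<phi> x)" if "\<phi> \<in> ?\<Phi>" for \<phi> and t :: "'x \<Rightarrow> 'k"
  proof -
    have "(\<Prod>i<d. t (\<phi> i)) = (\<Prod>x\<in>X. \<Prod>i\<in>{i\<in>{..<d}. \<phi> i = x}. t (\<phi> i))"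
      using that X by (intro prod.group[symmetric]) auto
    also have "\<dots> = (\<Prod>x\<in>X. t x ^ cnt \<phi> x)"
      by (intro prod.cong refl) (simp add: cnt_def)
    finally show ?thesis .
  qed
  have "f (\<Sum>x\<in>X. scale (t x) (v x)) =
    (\<Sum>m\<in>?M. (\<Sum>\<phi>\<in>{\<phi>\<in>?\<Phi>. cnt \<phi> = m}. B \<phi>) * (\<Prod>x\<in>X. t x ^ m x))" for t
  proof -
    have l: "l j i (\<Sum>x\<in>X. scale (t x) (v x)) = (\<Sum>x\<in>X. t x * l j i (v x))" if "j < n" "i < d" for j i
    proof -
      interpret Vector_Spaces.linear scale "(*)" "l j i" using lin that by blast
      show ?thesis by (simp add: sum scale)
    qed
    have "f (\<Sum>x\<in>X. scale (t x) (v x)) = (\<Sum>j<n. c j * (\<Prod>i<d. \<Sum>x\<in>X. t x * l j i (v x)))"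
      unfolding fdef by (intro sum.cong arg_cong2[where f = "(*)"] prod.cong refl l) auto
    also have "\<dots> = (\<Sum>j<n. c j * (\<Sum>\<phi>\<in>?\<Phi>. \<Prod>i<d. t (\<phi> i) * l j i (v (\<phi> i))))"
      using X by (subst prod_sum_PiE) auto
    also have "\<dots> = (\<Sum>\<phi>\<in>?\<Phi>. \<Sum>j<n. c j * (\<Prod>i<d. t (\<phi> i) * l j i (v (\<phi> i))))"
      unfolding sum_distrib_left by (rule sum.swap)
    also have "\<dots> = (\<Sum>\<phi>\<in>?\<Phi>. B \<phi> * (\<Prod>i<d. t (\<phi> i)))"
    proof (intro sum.cong refl)
      fix \<phi>
      show "(\<Sum>j<n. c j * (\<Prod>i<d. t (\<phi> i) * l j i (v (\<phi> i)))) = B \<phi> * (\<Prod>i<d. t (\<phi> i))"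
        unfolding B_def prod.distrib sum_distrib_right by (intro sum.cong refl) (simp only: ac_simps)
    qed
    also have "\<dots> = (\<Sum>\<phi>\<in>?\<Phi>. B \<phi> * (\<Prod>x\<in>X. t x ^ cnt \<phi> x))"
      by (intro sum.cong refl) (simp add: mono)
    also have "\<dots> = (\<Sum>m\<in>?M. \<Sum>\<phi>\<in>{\<phi>\<in>?\<Phi>. cnt \<phi> = m}. B \<phi> * (\<Prod>x\<in>X. t x ^ cnt \<phi> x))"
      using cntM by (intro sum.group[symmetric] fin\<Phi> finM)
    also have "\<dots> = (\<Sum>m\<in>?M. (\<Sum>\<phi>\<in>{\<phi>\<in>?\<Phi>. cnt \<phi> = m}. B \<phi>) * (\<Prod>x\<in>X. t x ^ m x))"
      unfolding sum_distrib_right by (intro sum.cong refl) auto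
    finally show ?thesis .
  qed
  then show thesis by (rule that)
qed


lemma (in G_module) card_le_degree_at_trace:
  assumes fin: "finite (carrier G)" and infk: "infinite (UNIV :: 'k set)"
    and p: "prime p" "CHAR('k) = p" and P: "subgroup P G" "card P = p ^ k"
    and f: "f \<in> homogeneous_invariants G scale \<rho> d" and "d > 0"
    and ne: "f (\<Sum>g\<in>carrier G. \<rho> g w) \<noteq> 0"
  shows "card P \<le> d"
proof -
  define M where "M = {m. (\<forall>x. x \<notin> carrier G \<longrightarrow> m x = 0) \<and> sum m (carrier G) = d}"
  define act where "act h m = (\<lambda>x. if x \<in> carrier G then m (inv h \<otimes> x) else 0)"
    for h and m :: "'g \<Rightarrow> nat"
  have PG: "h \<in> carrier G" if "h \<in> P" for h
    using P(1) that by (rule subgroup.mem_carrier)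
  have finM: "finite M" unfolding M_def by (rule finite_exponents [OF fin])
  have hom: "f \<in> homogeneous_functions scale d"
    and finv: "\<And>g v. g \<in> carrier G \<Longrightarrow> f (\<rho> (inv g) v) = f v"
    using f by (auto simp: homogeneous_invariants_def function_action_def fun_eq_iff)
  obtain A where A: "f (\<Sum>x\<in>carrier G. scale (t x) (\<rho> x w)) =
      (\<Sum>m\<in>M. A m * (\<Prod>x\<in>carrier G. t x ^ m x))" for t
    using homogeneous_on_combinations[OF hom fin, of "\<lambda>x. \<rho> x w"] unfolding M_def by blast
  have shift: "bij_betw (\<lambda>x. h \<otimes> x) (carrier G) (carrier G)" if "h \<in> carrier G" for h
    using that by (intro bij_betwI[where g = "\<lambda>x. inv h \<otimes> x"]) (auto simp flip: m_assoc)
  have act_closed: "act h m \<in> M" if "h \<in> carrier G" "m \<in> M" for h m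
    using that sum.reindex_bij_betw[OF shift[of "inv h"], of m] by (simp add: M_def act_def)
  have act_one: "act \<one> m = m" if "m \<in> M" for m
    using that by (auto simp: M_def act_def)
  have act_mult: "act (g \<otimes> h) m = act g (act h m)" if "g \<in> carrier G" "h \<in> carrier G" for g h m
    using that by (auto simp: act_def fun_eq_iff inv_mult_group m_assoc)
  have act_bij: "bij_betw (act h) M M" if "h \<in> carrier G" for h
    using that act_closed
    by (intro bij_betwI[where g = "act (inv h)"]) (auto simp flip: act_mult simp: act_one)
  have A_inv: "A (act h m) = A m" if h: "h \<in> carrier G" and m: "m \<in> M" for h m
  proof -
    have "(\<Sum>m\<in>M. (A (act h m) - A m) * (\<Prod>x\<in>carrier G. t x ^ m x)) = 0" for t
    proof -
      have "(\<Sum>x\<in>carrier G. scale (t (inv h \<otimes> x)) (\<rho> x w))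
          = (\<Sum>x\<in>carrier G. scale (t x) (\<rho> (h \<otimes> x) w))"
        using h by (subst sum.reindex_bij_betw[OF shift[OF h], symmetric]) (simp flip: m_assoc)
      also have "\<dots> = \<rho> h (\<Sum>x\<in>carrier G. scale (t x) (\<rho> x w))"
      proof -
        interpret Vector_Spaces.linear scale scale "\<rho> h" using action_linear h .
        show ?thesis using h by (simp add: sum scale action_mult)
      qed
      finally have "f (\<Sum>x\<in>carrier G. scale (t (inv h \<otimes> x)) (\<rho> x w))
          = f (\<Sum>x\<in>carrier G. scale (t x) (\<rho> x w))"
        using finv[of "inv h"] h by simp
      then have "(\<Sum>m\<in>M. A m * (\<Prod>x\<in>carrier G. t x ^ m x))
          = (\<Sum>m\<in>M. A m * (\<Prod>x\<in>carrier G. t (inv h \<otimes> x) ^ m x))"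
        unfolding A by simp
      also have "\<dots> = (\<Sum>m\<in>M. A (act h m) * (\<Prod>x\<in>carrier G. t (inv h \<otimes> x) ^ act h m x))"
        by (rule sum.reindex_bij_betw[OF act_bij[OF h], symmetric])
      also have "\<dots> = (\<Sum>m\<in>M. A (act h m) * (\<Prod>x\<in>carrier G. t x ^ m x))"
      proof (intro sum.cong refl arg_cong2[where f = "(*)"])
        fix m
        show "(\<Prod>x\<in>carrier G. t (inv h \<otimes> x) ^ act h m x) = (\<Prod>x\<in>carrier G. t x ^ m x)"
          using prod.reindex_bij_betw[OF shift[of "inv h"], of "\<lambda>x. t x ^ m x"] h
          by (simp add: act_def cong: prod.cong)
      qed
      finally show ?thesis by (simp add: left_diff_distrib sum_subtractf)
    qed
    then have "A (act h m) - A m = 0"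
      by (intro monomials_independent[OF infk fin finM _ _ m]) (auto simp: M_def fun_eq_iff)
    then show ?thesis by simp
  qed
  obtain m where m: "m \<in> M" "\<And>h. h \<in> P \<Longrightarrow> act h m = m"
  proof (rule ccontr)
    assume nofix: "\<not> thesis"
    interpret P: group "G\<lparr>carrier := P\<rparr>"
      by (rule subgroup_imp_group) (fact P)
    interpret act: group_action "G\<lparr>carrier := P\<rparr>" M "\<lambda>h. restrict (act h) M"
      by (rule P.group_action_restrict) (auto simp: act_closed act_one act_mult PG)
    have "(\<Sum>m\<in>M. A m) = 0"
      by (rule act.p_group_sum_eq_0[OF p _ finM])
        (use nofix that P in \<open>auto simp: A_inv PG Coset.order_def\<close>)
    moreover have "f (\<Sum>g\<in>carrier G. \<rho> g w) = (\<Sum>m\<in>M. A m)"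
      using A[of "\<lambda>_. 1"] by simp
    ultimately show False using ne by simp
  qed
  obtain g where g: "g \<in> carrier G" "m g > 0"
    using \<open>d > 0\<close> m(1) by (force simp: M_def intro: ccontr)
  have const: "m (h \<otimes> g) = m g" if "h \<in> P" for h
    using fun_cong[OF m(2)[OF that], of "h \<otimes> g"] that g PG by (simp add: act_def flip: m_assoc)
  have "card P \<le> card P * m g" using g by simp
  also have "\<dots> = (\<Sum>h\<in>P. m (h \<otimes> g))" using const by simp
  also have "\<dots> = sum m ((\<lambda>h. h \<otimes> g) ` P)"
    using g PG by (subst sum.reindex) (auto intro!: inj_onI)
  also have "\<dots> \<le> sum m (carrier G)"
    using g PG fin by (intro sum_mono2) auto
  also have "\<dots> = d" using m(1) by (simp add: M_def)
  finally show ?thesis .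
qed

lemma (in G_module) projective_fixed_point_is_trace:
  assumes fin: "finite (carrier G)" and proj: "projective_module G scale \<rho>"
    and u: "u \<in> fixed_points G \<rho>"
  obtains w where "u = (\<Sum>g\<in>carrier G. \<rho> g w)"
proof -
  obtain n \<iota> \<pi> where \<iota>: "\<iota> \<in> hom_to_free G scale \<rho> n"
    and \<pi>: "\<pi> \<in> hom_from_free G scale \<rho> n" and id: "\<And>v. \<pi> (\<iota> v) = v"
    using proj unfolding projective_module_def by blast
  have \<pi>add: "\<pi> (\<lambda>i g. x i g + y i g) = \<pi> x + \<pi> y"
    if "x \<in> free_module G n" "y \<in> free_module G n" for x y
    using \<pi> that unfolding hom_from_free_def by blast
  have \<pi>act: "\<pi> (free_action G h x) = \<rho> h (\<pi> x)" if "h \<in> carrier G" "x \<in> free_module G n" for h x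
    using \<pi> that unfolding hom_from_free_def by blast
  have zero: "\<pi> (\<lambda>i g. 0) = 0"
    using \<pi>add[of "\<lambda>i g. 0" "\<lambda>i g. 0"] by (simp add: free_module_def)
  have sum_free: "(\<lambda>i g. \<Sum>s\<in>S. y s i g) \<in> free_module G n \<and>
      \<pi> (\<lambda>i g. \<Sum>s\<in>S. y s i g) = (\<Sum>s\<in>S. \<pi> (y s))"
    if "finite S" "\<And>s. s \<in> S \<Longrightarrow> y s \<in> free_module G n" for S :: "'g set" and y
    using that
  proof (induction S rule: finite_induct)
    case empty
    then show ?case by (simp add: zero free_module_def)
  next
    case (insert s S)
    then have y: "y s \<in> free_module G n" "(\<lambda>i g. \<Sum>s\<in>S. y s i g) \<in> free_module G n"
      "\<pi> (\<lambda>i g. \<Sum>s\<in>S. y s i g) = (\<Sum>s\<in>S. \<pi> (y s))"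
      by auto
    have "(\<lambda>i g. y s i g + (\<Sum>s\<in>S. y s i g)) \<in> free_module G n"
    proof -
      have "i < n \<and> g \<in> carrier G" if "y s i g + (\<Sum>s\<in>S. y s i g) \<noteq> 0" for i g
      proof -
        have "y s i g \<noteq> 0 \<or> (\<Sum>s\<in>S. y s i g) \<noteq> 0" using that by auto
        then show ?thesis using y(1,2) unfolding free_module_def by blast
      qed
      then show ?thesis unfolding free_module_def by blast
    qed
    then show ?case
      using insert.hyps \<pi>add[OF y(1,2)] y(3) by simp
  qed
  have \<iota>free: "\<iota> u \<in> free_module G n" using \<iota> by (simp add: hom_to_free_def)
  have const: "\<iota> u i g = \<iota> u i \<one>" if "g \<in> carrier G" for i g
  proof -
    have "\<iota> (\<rho> g u) = free_action G g (\<iota> u)" using \<iota> that by (auto simp: hom_to_free_def)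
    moreover have "\<rho> g u = u" using u that by (simp add: fixed_points_def)
    ultimately have "\<iota> u i g = free_action G g (\<iota> u) i g" by simp
    then show ?thesis using that by (simp add: free_action_def)
  qed
  define e where "e = (\<lambda>i g. if g = \<one> then \<iota> u i \<one> else 0)"
  have e: "e \<in> free_module G n"
    using \<iota>free by (auto simp: e_def free_module_def)
  have act_e: "free_action G g e = (\<lambda>i x. if x = g then \<iota> u i \<one> else 0)" if "g \<in> carrier G" for g
  proof (intro ext)
    fix i x
    have "inv g \<otimes> x = \<one> \<longleftrightarrow> x = g" if "x \<in> carrier G"
      using that \<open>g \<in> carrier G\<close> inv_solve_left'[of \<one> g x] by auto
    then show "free_action G g e i x = (if x = g then \<iota> u i \<one> else 0)"
      using that by (auto simp: free_action_def e_def)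
  qed
  have act_free: "free_action G g e \<in> free_module G n" if "g \<in> carrier G" for g
    using \<iota>free that unfolding act_e[OF that] by (auto simp: free_module_def)
  have "\<iota> u = (\<lambda>i x. \<Sum>g\<in>carrier G. free_action G g e i x)"
  proof (intro ext)
    fix i x
    have "(\<Sum>g\<in>carrier G. free_action G g e i x)
        = (\<Sum>g\<in>carrier G. if x = g then \<iota> u i \<one> else 0)"
      by (intro sum.cong refl) (simp add: act_e)
    also have "\<dots> = (if x \<in> carrier G then \<iota> u i \<one> else 0)"
      using fin by (rule sum.delta')
    also have "\<dots> = \<iota> u i x"
    proof (cases "x \<in> carrier G")
      case True
      show ?thesis using True unfolding const[OF True] by (rule if_P)
    next
      case False
      then have "\<iota> u i x = 0" using \<iota>free unfolding free_module_def by blast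
      with False show ?thesis by simp
    qed
    finally show "\<iota> u i x = (\<Sum>g\<in>carrier G. free_action G g e i x)" ..
  qed
  then have "u = \<pi> (\<lambda>i x. \<Sum>g\<in>carrier G. free_action G g e i x)"
    using id[of u] by simp
  also have "\<dots> = (\<Sum>g\<in>carrier G. \<pi> (free_action G g e))"
    using sum_free[of "carrier G" "\<lambda>g. free_action G g e", OF fin act_free] by (rule conjunct2)
  also have "\<dots> = (\<Sum>g\<in>carrier G. \<rho> g (\<pi> e))"
    by (intro sum.cong refl) (rule \<pi>act[OF _ e])
  finally show thesis by (rule that)
qed

lemma (in vector_space) functional_nonzero_at:
  assumes "u \<noteq> 0"
  obtains l where "Vector_Spaces.linear scale (*) l" "l u = 1"
proof -
  have ind: "independent {u}" using assms by simp
  let ?B = "extend_basis {u}"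
  have "independent ?B" "span ?B = UNIV" "u \<in> ?B"
    using independent_extend_basis[OF ind] span_extend_basis[OF ind] extend_basis_superset[OF ind]
    by auto
  then show thesis
    using that[of "\<lambda>v. representation ?B v u"] linear_representation representation_basis by simp
qed

lemma (in G_module) norm_transfer_invariant:
  assumes fin: "finite (carrier G)" and P: "subgroup P G" and l: "Vector_Spaces.linear scale (*) l"
  shows "(\<lambda>v. \<Sum>D\<in>rcosets P. \<Prod>h\<in>D. l (\<rho> h v)) \<in> homogeneous_invariants G scale \<rho> (card P)"
proof -
  have Psub: "P \<subseteq> carrier G" using P by (rule subgroup.subset)
  have finD: "finite (rcosets P)"
    using rcosets_subset_PowG[OF P] fin by (meson finite_Pow_iff finite_subset)
  have D: "D \<subseteq> carrier G" "finite D" "card D = card P" if "D \<in> rcosets P" for D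
  proof -
    show sub: "D \<subseteq> carrier G" using rcosets_subset_PowG[OF P] that by blast
    then show "finite D" using fin by (rule finite_subset)
    show "card D = card P" using card_rcosets_equal[OF that Psub] by simp
  qed
  obtain b where b: "bij_betw b {..<card (rcosets P)} (rcosets P)"
    using ex_bij_betw_nat_finite[OF finD] by (auto simp: atLeast0LessThan)
  have "\<exists>e. bij_betw e {..<card P} D" if "D \<in> rcosets P" for D
    using ex_bij_betw_nat_finite[OF D(2)[OF that]] D(3)[OF that] by (auto simp: atLeast0LessThan)
  then obtain e where e: "\<And>D. D \<in> rcosets P \<Longrightarrow> bij_betw (e D) {..<card P} D" by metis
  have "(\<Sum>D\<in>rcosets P. \<Prod>h\<in>D. l (\<rho> h v))
      = (\<Sum>j<card (rcosets P). 1 * (\<Prod>i<card P. l (\<rho> (e (b j) i) v)))" for v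
  proof -
    have "(\<Sum>D\<in>rcosets P. \<Prod>h\<in>D. l (\<rho> h v)) = (\<Sum>j<card (rcosets P). \<Prod>h\<in>b j. l (\<rho> h v))"
      by (rule sum.reindex_bij_betw[OF b, symmetric])
    also have "\<dots> = (\<Sum>j<card (rcosets P). 1 * (\<Prod>i<card P. l (\<rho> (e (b j) i) v)))"
    proof (intro sum.cong refl)
      fix j assume "j \<in> {..<card (rcosets P)}"
      then have "b j \<in> rcosets P" using bij_betwE[OF b] by blast
      from prod.reindex_bij_betw[OF e[OF this], of "\<lambda>h. l (\<rho> h v)"]
      show "(\<Prod>h\<in>b j. l (\<rho> h v)) = 1 * (\<Prod>i<card P. l (\<rho> (e (b j) i) v))" by simp
    qed
    finally show ?thesis .
  qed
  moreover have "Vector_Spaces.linear scale (*) (\<lambda>v. l (\<rho> (e (b j) i) v))"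
    if "j < card (rcosets P)" "i < card P" for j i
  proof -
    have "b j \<in> rcosets P" using bij_betwE[OF b] that by simp
    then have "e (b j) i \<in> carrier G" using bij_betwE[OF e] D(1) that by blast
    then show ?thesis
      using Vector_Spaces.linear_compose[OF action_linear l] by (simp add: o_def)
  qed
  ultimately have hom: "(\<lambda>v. \<Sum>D\<in>rcosets P. \<Prod>h\<in>D. l (\<rho> h v)) \<in> homogeneous_functions scale (card P)"
    unfolding homogeneous_functions_def mem_Collect_eq
    by (intro exI[of _ "card (rcosets P)"] exI[of _ "\<lambda>_. 1"]
        exI[of _ "\<lambda>j i v. l (\<rho> (e (b j) i) v)"]) auto
  have "(\<Sum>D\<in>rcosets P. \<Prod>h\<in>D. l (\<rho> h (\<rho> (inv g) v))) = (\<Sum>D\<in>rcosets P. \<Prod>h\<in>D. l (\<rho> h v))"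
    if g: "g \<in> carrier G" for g v
  proof -
    have cl: "D #> x \<in> rcosets P" if D': "D \<in> rcosets P" and x: "x \<in> carrier G" for D x
    proof -
      obtain a where "a \<in> carrier G" "D = P #> a" using D' by (auto simp: RCOSETS_def)
      then show ?thesis using x Psub by (auto simp: coset_mult_assoc intro: rcosetsI)
    qed
    have bij: "bij_betw (\<lambda>D. D #> inv g) (rcosets P) (rcosets P)"
      using g cl D(1)
      by (intro bij_betwI[where g = "\<lambda>D. D #> g"]) (auto simp: coset_mult_assoc coset_mult_one)
    have "(\<Sum>D\<in>rcosets P. \<Prod>h\<in>D. l (\<rho> h (\<rho> (inv g) v)))
        = (\<Sum>D\<in>rcosets P. \<Prod>h\<in>D #> inv g. l (\<rho> h v))"
    proof (intro sum.cong refl)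
      fix D assume D': "D \<in> rcosets P"
      have im: "D #> inv g = (\<lambda>h. h \<otimes> inv g) ` D" by (auto simp: r_coset_def)
      have inj: "inj_on (\<lambda>h. h \<otimes> inv g) D"
        using D(1)[OF D'] g by (intro inj_onI) (metis inv_closed right_cancel subsetD)
      have "(\<Prod>h\<in>D #> inv g. l (\<rho> h v)) = (\<Prod>h\<in>D. l (\<rho> (h \<otimes> inv g) v))"
        unfolding im by (simp add: prod.reindex[OF inj])
      also have "\<dots> = (\<Prod>h\<in>D. l (\<rho> h (\<rho> (inv g) v)))"
        using D(1)[OF D'] g by (intro prod.cong refl) (auto simp: action_mult)
      finally show "(\<Prod>h\<in>D. l (\<rho> h (\<rho> (inv g) v))) = (\<Prod>h\<in>D #> inv g. l (\<rho> h v))" ..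
    qed
    also have "\<dots> = (\<Sum>D\<in>rcosets P. \<Prod>h\<in>D. l (\<rho> h v))"
      by (rule sum.reindex_bij_betw[OF bij])
    finally show ?thesis .
  qed
  then show ?thesis
    using hom by (simp add: homogeneous_invariants_def function_action_def)
qed

lemma (in G_module) exists_invariant_of_sylow_degree:
  assumes fin: "finite (carrier G)" and p: "prime p" "CHAR('k) = p" and P: "sylow_subgroup p P G"
    and u: "u \<in> fixed_points G \<rho>" "u \<noteq> 0"
  obtains f where "f \<in> homogeneous_invariants G scale \<rho> (card P)" "f u \<noteq> 0"
proof -
  have sub: "subgroup P G" and card: "card P = p ^ multiplicity p (Coset.order G)"
    using P by (auto simp: sylow_subgroup_def)
  obtain l where l: "Vector_Spaces.linear scale (*) l" "l u = 1"
    using functional_nonzero_at[OF u(2)] .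
  have "(\<Prod>h\<in>D. l (\<rho> h u)) = 1" if "D \<in> rcosets P" for D
  proof -
    have "D \<subseteq> carrier G" using rcosets_subset_PowG[OF sub] that by blast
    then have "\<rho> h u = u" if "h \<in> D" for h using that u(1) by (auto simp: fixed_points_def)
    then show ?thesis by (simp add: l(2))
  qed
  then have "(\<Sum>D\<in>rcosets P. \<Prod>h\<in>D. l (\<rho> h u)) = of_nat (card (rcosets P))"
    by simp
  moreover have "\<not> p dvd card (rcosets P)"
  proof
    assume "p dvd card (rcosets P)"
    then have "p ^ Suc (multiplicity p (Coset.order G)) dvd Coset.order G"
      using lagrange[OF sub] mult_dvd_mono[OF _ dvd_refl, of p "card (rcosets P)" "card P"]
      by (simp add: card)
    moreover have "Coset.order G \<noteq> 0" "\<not> is_unit p"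
      using fin order_gt_0_iff_finite p(1) by auto
    ultimately show False
      using power_dvd_iff_le_multiplicity[of "Coset.order G" p "Suc (multiplicity p (Coset.order G))"]
      by (metis not_less_eq_eq order_refl)
  qed
  ultimately have "(\<Sum>D\<in>rcosets P. \<Prod>h\<in>D. l (\<rho> h u)) \<noteq> 0"
    using p(2) by (simp add: of_nat_eq_0_iff_char_dvd)
  then show thesis
    by (rule that[OF norm_transfer_invariant[OF fin sub l(1)]])
qed

lemma homogeneous_functions_subset_polynomial_functions:
  "homogeneous_functions scale d \<subseteq> polynomial_functions scale"
proof
  fix f assume "f \<in> homogeneous_functions scale d"
  then obtain n :: nat and c l where f: "f = (\<lambda>u. \<Sum>j<n. c j * (\<Prod>i<d. l j i u))"
    and l: "\<forall>j<n. \<forall>i<d. Vector_Spaces.linear scale (*) (l j i)"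
    unfolding homogeneous_functions_def mem_Collect_eq
    by (elim exE conjE) (rule that)
  have prod: "(\<lambda>u. \<Prod>i<e. l j i u) \<in> polynomial_functions scale" if "e \<le> d" "j < n" for e j
    using that
  proof (induction e)
    case 0
    show ?case by (simp add: polynomial_functions.const)
  next
    case (Suc e)
    then show ?case
      using polynomial_functions.mult[OF Suc.IH polynomial_functions.functional] l by simp
  qed
  have "(\<lambda>u. \<Sum>j<k. c j * (\<Prod>i<d. l j i u)) \<in> polynomial_functions scale" if "k \<le> n" for k
    using that
  proof (induction k)
    case 0
    show ?case by (simp add: polynomial_functions.const)
  next
    case (Suc k)
    then show ?case
      using polynomial_functions.add[OF Suc.IH
          polynomial_functions.mult[OF polynomial_functions.const prod]] by simp
  qed
  then show "f \<in> polynomial_functions scale" unfolding f by simp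
qed

lemma homogeneous_function_at_zero:
  assumes "f \<in> homogeneous_functions scale d" "d > 0"
  shows "f 0 = 0"
proof -
  obtain n :: nat and c l where f: "f = (\<lambda>u. \<Sum>j<n. c j * (\<Prod>i<d. l j i u))"
    and l: "\<forall>j<n. \<forall>i<d. Vector_Spaces.linear scale (*) (l j i)"
    using assms(1) unfolding homogeneous_functions_def mem_Collect_eq
    by (elim exE conjE) (rule that)
  have prod0: "(\<Prod>i<d. l j i 0) = 0" if "j < n" for j
  proof -
    interpret Vector_Spaces.linear scale "(*)" "l j 0" using l that assms by blast
    show ?thesis using assms(2) zero by (intro prod_zero bexI[of _ 0]) auto
  qed
  show ?thesis
    unfolding f by (intro sum.neutral ballI) (simp only: lessThan_iff prod0 mult_zero_right)
qed

theorem corollary3p3: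
  fixes G :: "'g monoid" and P :: "'g set" and p :: nat
    and scale :: "'k::alg_closed_field \<Rightarrow> 'v::ab_group_add \<Rightarrow> 'v"
    and \<rho> :: "'g \<Rightarrow> 'v \<Rightarrow> 'v"
  assumes "CHAR('k) = p" and "p > 0"
    and "group G" and "finite (carrier G)"
    and "sylow_subgroup p P G"
    and "fin_dim_G_module G scale \<rho>"
    and "projective_module G scale \<rho>"
  shows "(\<forall>u \<in> fixed_points G \<rho> - {0}. epsilon_point G scale \<rho> u = enat (card P)) \<and>
    (fixed_points G \<rho> \<noteq> {0} \<longrightarrow> epsilon G scale \<rho> = enat (card P))"
proof -
  interpret fin_dim_G_module G scale \<rho> by fact
  have p: "prime p" using assms(1,2) prime_CHAR_semidom[where 'a = 'k] by simp
  have P: "subgroup P G" "card P = p ^ multiplicity p (Coset.order G)"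
    using assms(5) by (auto simp: sylow_subgroup_def)
  have P_pos: "card P > 0" using P(2) p by (simp add: prime_gt_0_nat)
  have point: "epsilon_point G scale \<rho> u = enat (card P)"
    if u: "u \<in> fixed_points G \<rho>" "u \<noteq> 0" for u
    unfolding epsilon_point_def
  proof (rule Inf_eqI)
    fix e assume "e \<in> {enat d | d. d > 0 \<and> (\<exists>f\<in>homogeneous_invariants G scale \<rho> d. f u \<noteq> 0)}"
    then obtain d f where d: "e = enat d" "d > 0" "f \<in> homogeneous_invariants G scale \<rho> d" "f u \<noteq> 0"
      by blast
    obtain w where "u = (\<Sum>g\<in>carrier G. \<rho> g w)"
      using projective_fixed_point_is_trace[OF assms(4,7) u(1)] .
    then show "enat (card P) \<le> e"
      using card_le_degree_at_trace[OF assms(4) infinite_UNIV_alg_closed_field p assms(1) P d(3,2)]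
        d(1,4) by simp
  next
    fix y assume y: "\<And>e. e \<in> {enat d | d. d > 0 \<and>
        (\<exists>f\<in>homogeneous_invariants G scale \<rho> d. f u \<noteq> 0)} \<Longrightarrow> y \<le> e"
    obtain f where "f \<in> homogeneous_invariants G scale \<rho> (card P)" "f u \<noteq> 0"
      using exists_invariant_of_sylow_degree[OF assms(4) p assms(1,5) u] .
    then show "y \<le> enat (card P)" using P_pos by (intro y) blast
  qed
  have "epsilon G scale \<rho> = enat (card P)" if nz: "fixed_points G \<rho> \<noteq> {0}"
  proof -
    have sub: "u \<noteq> 0" if "u \<notin> nullcone G scale \<rho>" for u
      using that by (auto simp: nullcone_def)
    have "\<rho> g 0 = 0" if "g \<in> carrier G" for g
    proof -
      interpret Vector_Spaces.linear scale scale "\<rho> g" using action_linear that .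
      show ?thesis by (rule zero)
    qed
    then have "0 \<in> fixed_points G \<rho>" by (simp add: fixed_points_def)
    then obtain u where u: "u \<in> fixed_points G \<rho>" "u \<noteq> 0" using nz by blast
    obtain f where f: "f \<in> homogeneous_invariants G scale \<rho> (card P)" "f u \<noteq> 0"
      using exists_invariant_of_sylow_degree[OF assms(4) p assms(1,5) u] .
    then have "f \<in> Defs.invariants G scale \<rho>" "f 0 = 0"
      using homogeneous_functions_subset_polynomial_functions homogeneous_function_at_zero[OF _ P_pos]
      by (auto simp: homogeneous_invariants_def Defs.invariants_def)
    then have "u \<notin> nullcone G scale \<rho>" using f(2) by (auto simp: nullcone_def)
    then have "fixed_points G \<rho> - nullcone G scale \<rho> \<noteq> {}" using u by blast
    moreover have "epsilon_point G scale \<rho> v = enat (card P)"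
      if "v \<in> fixed_points G \<rho> - nullcone G scale \<rho>" for v
      using that sub point by blast
    ultimately have "epsilon_point G scale \<rho> ` (fixed_points G \<rho> - nullcone G scale \<rho>)
        = {enat (card P)}" by (auto simp: image_iff)
    then show ?thesis by (simp add: epsilon_def)
  qed
  with point show ?thesis by blast
qed

end
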